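(* For any $n,m\ge1$, $\mathsf S\subseteq[n-1]$, $\mathsf T\subseteq[m-1]$, and $i\in[n]$, $$M_{\mathsf S}\circ_i M_{\mathsf T}=M_{B_i(\mathsf S,\mathsf T)} .$$
   Context: $\Bbbk$ is a commutative ring; $[n]=\{1,\dots,n\}$ (with $[0]=\emptyset$). $Q_n$ is the set of subsets of $[n-1]$, and $\Bbbk Q_n$ is the free $\Bbbk$-module with basis $\{F_{\mathsf S}\}_{\mathsf S\subseteq[n-1]}$. For a set of integers $\mathsf S$ and an integer $p$, $\mathsf S+p:=\{s+p:s\in\mathsf S\}$. For $\mathsf S\subseteq[n-1]$, $\mathsf T\subseteq[m-1]$, $i\in[n]$, $$B_i(\mathsf S,\mathsf T):=(\mathsf S\cap\{1,\dots,i-1\})\cup(\mathsf T+i-1)\cup\bigl((\mathsf S\cap\{i,\dots,n-1\})+m-1\bigr)\subseteq[n+m-2].$$ The linear maps $\circ_i:\Bbbk Q_n\otimes\Bbbk Q_m\to\Bbbk Q_{n+m-1}$ are defined by $F_{\mathsf S}\circ_iF_{\mathsf T}:=F_{B_i(\mathsf S,\mathsf T)}$. The monomial basis of $\Bbbk Q_n$ is $$M_{\mathsf S}:=\sum_{\mathsf S\subseteq\mathsf T\subseteq[n-1]}(-1)^{\#(\mathsf T\setminus\mathsf S)}F_{\mathsf T}.$$ *)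

theory Defs
  imports "HOL-Library.Poly_Mapping"
begin

text \<open>
  The coefficient ring has sort \<open>{comm_ring, comm_monoid_mult}\<close>: a commutative ring with unit.
  Unlike \<open>comm_ring_1\<close>, this does not impose \<open>0 \<noteq> 1\<close>, so the zero ring is allowed.

  All the free modules \<open>kQ\<^sub>n\<close> are realised inside the single type \<open>nat set \<Rightarrow>\<^sub>0 'k\<close> of finitely
  supported functions: \<open>kQ n\<close> consists of those supported on subsets of \<open>{1..n - 1}\<close>. In
  particular the ambient \<open>n\<close> is not determined by an element and is passed explicitly
  where it matters.
\<close>

definition Q :: "nat \<Rightarrow> nat set set"
  where "Q n = Pow {1..n - 1}"

definition kQ :: "nat \<Rightarrow> (nat set \<Rightarrow>\<^sub>0 'k::{comm_ring, comm_monoid_mult}) set"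
  where "kQ n = {x. Poly_Mapping.keys x \<subseteq> Q n}"

definition smult :: "'k \<Rightarrow> (nat set \<Rightarrow>\<^sub>0 'k) \<Rightarrow> (nat set \<Rightarrow>\<^sub>0 'k::{comm_ring, comm_monoid_mult})"
    (infixr \<open>\<cdot>\<close> 75)
  where "c \<cdot> x = Poly_Mapping.map ((*) c) x"

definition F :: "nat set \<Rightarrow> (nat set \<Rightarrow>\<^sub>0 'k::{comm_ring, comm_monoid_mult})"
  where "F S = Poly_Mapping.single S 1"

definition shift :: "nat set \<Rightarrow> nat \<Rightarrow> nat set"
  where "shift S p = (\<lambda>s. s + p) ` S"

definition B :: "nat \<Rightarrow> nat \<Rightarrow> nat \<Rightarrow> nat set \<Rightarrow> nat set \<Rightarrow> nat set"
  where "B n m i S T =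
    (S \<inter> {1..i - 1}) \<union> shift T (i - 1) \<union> shift (S \<inter> {i..n - 1}) (m - 1)"

text \<open>
  The linear map \<open>\<circ>\<^sub>i\<close> on \<open>kQ\<^sub>n \<otimes> kQ\<^sub>m\<close> is given as a bilinear operation: the bilinear extension
  of \<open>F S \<circ>\<^sub>i F T = F (B n m i S T)\<close>.
\<close>

definition pcomp :: "nat \<Rightarrow> nat \<Rightarrow> nat \<Rightarrow> (nat set \<Rightarrow>\<^sub>0 'k) \<Rightarrow> (nat set \<Rightarrow>\<^sub>0 'k)
    \<Rightarrow> (nat set \<Rightarrow>\<^sub>0 'k::{comm_ring, comm_monoid_mult})"
  where "pcomp n m i x y =
    (\<Sum>S\<in>Poly_Mapping.keys x. \<Sum>T\<in>Poly_Mapping.keys y.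
       (Poly_Mapping.lookup x S * Poly_Mapping.lookup y T) \<cdot> F (B n m i S T))"

definition M :: "nat \<Rightarrow> nat set \<Rightarrow> (nat set \<Rightarrow>\<^sub>0 'k::{comm_ring, comm_monoid_mult})"
  where "M n S = (\<Sum>T | S \<subseteq> T \<and> T \<subseteq> {1..n - 1}. (- 1) ^ card (T - S) \<cdot> F T)"

text \<open>
  Sanity checks: \<open>\<cdot>\<close> is the pointwise action, \<open>B\<close> and \<open>pcomp\<close> land in the right place, and
  \<open>pcomp\<close> is bilinear with the prescribed values on the basis.
\<close>

lemma lookup_smult: "Poly_Mapping.lookup (c \<cdot> x) S = c * Poly_Mapping.lookup x S"
  by (simp add: smult_def Poly_Mapping.map.rep_eq when_def)

lemma smult_single: "c \<cdot> Poly_Mapping.single S a = Poly_Mapping.single S (c * a)"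
  by (rule poly_mapping_eqI) (simp add: lookup_smult lookup_single when_def)

lemma smult_F: "c \<cdot> F S = Poly_Mapping.single S c"
  by (simp add: F_def smult_single)

lemma F_expansion: "x = (\<Sum>S\<in>Poly_Mapping.keys x. Poly_Mapping.lookup x S \<cdot> F S)"
  by (rule poly_mapping_eqI)
     (simp add: smult_F lookup_sum lookup_single when_def sum.delta in_keys_iff)

lemma B_in_Q:
  assumes "n \<ge> 1" "m \<ge> 1" "i \<in> {1..n}" "S \<in> Q n" "T \<in> Q m"
  shows "B n m i S T \<in> Q (n + m - 1)"
  using assms by (fastforce simp: Q_def B_def shift_def)

lemma pcomp_superset:
  assumes "finite K" "Poly_Mapping.keys x \<subseteq> K" "finite L" "Poly_Mapping.keys y \<subseteq> L"
  shows "pcomp n m i x y = (\<Sum>S\<in>K. \<Sum>T\<in>L.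
     Poly_Mapping.single (B n m i S T) (Poly_Mapping.lookup x S * Poly_Mapping.lookup y T))"
proof -
  have "pcomp n m i x y = (\<Sum>S\<in>Poly_Mapping.keys x. \<Sum>T\<in>L.
     Poly_Mapping.single (B n m i S T) (Poly_Mapping.lookup x S * Poly_Mapping.lookup y T))"
    unfolding pcomp_def smult_F
    by (intro sum.cong refl sum.mono_neutral_left assms) (simp add: in_keys_iff)
  also have "\<dots> = (\<Sum>S\<in>K. \<Sum>T\<in>L.
     Poly_Mapping.single (B n m i S T) (Poly_Mapping.lookup x S * Poly_Mapping.lookup y T))"
    by (intro sum.mono_neutral_left assms) (simp add: in_keys_iff)
  finally show ?thesis .
qed

lemma pcomp_F: "pcomp n m i (F S) (F T) = F (B n m i S T)"
  by (subst pcomp_superset[of "{S}" _ "{T}"]) (simp_all add: F_def)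

lemma pcomp_add_left: "pcomp n m i (x + x') y = pcomp n m i x y + pcomp n m i x' y"
proof -
  let ?K = "Poly_Mapping.keys x \<union> Poly_Mapping.keys x'" and ?L = "Poly_Mapping.keys y"
  have *: "pcomp n m i z y = (\<Sum>S\<in>?K. \<Sum>T\<in>?L.
     Poly_Mapping.single (B n m i S T) (Poly_Mapping.lookup z S * Poly_Mapping.lookup y T))"
    if "Poly_Mapping.keys z \<subseteq> ?K" for z
    using that by (intro pcomp_superset) auto
  show ?thesis
    by (simp add: * Poly_Mapping.keys_add lookup_add distrib_right single_add sum.distrib)
qed

lemma pcomp_add_right: "pcomp n m i x (y + y') = pcomp n m i x y + pcomp n m i x y'"
proof -
  let ?K = "Poly_Mapping.keys x" and ?L = "Poly_Mapping.keys y \<union> Poly_Mapping.keys y'"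
  have *: "pcomp n m i x z = (\<Sum>S\<in>?K. \<Sum>T\<in>?L.
     Poly_Mapping.single (B n m i S T) (Poly_Mapping.lookup x S * Poly_Mapping.lookup z T))"
    if "Poly_Mapping.keys z \<subseteq> ?L" for z
    using that by (intro pcomp_superset) auto
  show ?thesis
    by (simp add: * Poly_Mapping.keys_add lookup_add distrib_left single_add sum.distrib)
qed

lemma smult_add: "c \<cdot> (x + y) = c \<cdot> x + c \<cdot> y"
  by (rule poly_mapping_eqI) (simp add: lookup_smult lookup_add distrib_left)

lemma smult_sum: "c \<cdot> sum f A = (\<Sum>a\<in>A. c \<cdot> f a)"
  by (rule poly_mapping_eqI) (simp add: lookup_smult lookup_sum sum_distrib_left)

lemma keys_smult: "Poly_Mapping.keys (c \<cdot> x) \<subseteq> Poly_Mapping.keys x"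
  by (auto simp: in_keys_iff lookup_smult)

lemma pcomp_smult_left: "pcomp n m i (c \<cdot> x) y = c \<cdot> pcomp n m i x y"
  by (subst (1 2) pcomp_superset[of "Poly_Mapping.keys x" _ "Poly_Mapping.keys y"])
     (simp_all add: keys_smult lookup_smult smult_sum smult_single mult.assoc)

lemma pcomp_smult_right: "pcomp n m i x (c \<cdot> y) = c \<cdot> pcomp n m i x y"
  by (subst (1 2) pcomp_superset[of "Poly_Mapping.keys x" _ "Poly_Mapping.keys y"])
     (simp_all add: keys_smult lookup_smult smult_sum smult_single mult.left_commute)

lemma kQ_add: "x \<in> kQ n \<Longrightarrow> y \<in> kQ n \<Longrightarrow> x + y \<in> kQ n"
  using Poly_Mapping.keys_add[of x y] by (auto simp: kQ_def)

lemma kQ_sum: "(\<And>a. a \<in> A \<Longrightarrow> f a \<in> kQ n) \<Longrightarrow> sum f A \<in> kQ n"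
  by (induction A rule: infinite_finite_induct) (auto simp: kQ_add, simp_all add: kQ_def)

lemma smult_F_in_kQ: "S \<in> Q n \<Longrightarrow> c \<cdot> F S \<in> kQ n"
  by (simp add: smult_F kQ_def)

lemma M_in_kQ: "M n S \<in> kQ n"
  unfolding M_def by (intro kQ_sum smult_F_in_kQ) (simp add: Q_def)

lemma pcomp_in_kQ:
  assumes "n \<ge> 1" "m \<ge> 1" "i \<in> {1..n}" "x \<in> kQ n" "y \<in> kQ m"
  shows "pcomp n m i x y \<in> kQ (n + m - 1)"
  unfolding pcomp_def using assms
  by (intro kQ_sum smult_F_in_kQ B_in_Q) (auto simp: kQ_def)

end

theory Submission
  imports Defs
begin

text \<open>
  The operation \<open>B n m i\<close> is a Boolean phenomenon. There is a bijection \<open>slot m i\<close> from the disjoint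
  union of \<open>[n-1]\<close> and \<open>[m-1]\<close> onto \<open>[n+m-2]\<close>, which inserts a block of \<open>m-1\<close> places just before
  the place \<open>i\<close>, and \<open>B n m i S T\<close> is the image under it of the disjoint union of \<open>S\<close> and \<open>T\<close>
  (lemma \<open>B_eq_slot_image\<close>). Hence \<open>B n m i\<close> identifies the product of the Boolean lattices of
  \<open>[n-1]\<close> and \<open>[m-1]\<close> with that of \<open>[n+m-2]\<close>: it carries a product of two upper intervals
  bijectively onto an upper interval (\<open>bij_betw_B\<close>), and the sizes of relative complements add up
  (\<open>card_B_diff\<close>).

  Expanding the left-hand side bilinearly gives the signed sum of \<open>F (B n m i S' T')\<close> over all
  \<open>S' \<supseteq> S\<close> and \<open>T' \<supseteq> T\<close>, with sign \<open>(-1)\<close> to the power \<open>#(S' - S) + #(T' - T)\<close>. Under the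
  identification this is, term by term, the sum that defines the right-hand side; no cancellation
  takes place.
\<close>

text \<open>
  The left summand carries the places of the outer set, those from \<open>i\<close> onwards being pushed to the
  right by \<open>m-1\<close>; the right summand carries the inserted block.
\<close>
definition slot :: "nat \<Rightarrow> nat \<Rightarrow> nat + nat \<Rightarrow> nat" where
  "slot m i = case_sum (\<lambda>s. if s < i then s else s + (m - 1)) (\<lambda>t. t + (i - 1))"

lemma slot_simps [simp]:
  "slot m i (Inl s) = (if s < i then s else s + (m - 1))"
  "slot m i (Inr t) = t + (i - 1)"
  by (simp_all add: slot_def)

text \<open>
  The left elements below \<open>i\<close>, the right elements, and the left elements from \<open>i\<close> onwards fill the
  consecutive intervals \<open>[1, i-1]\<close>, \<open>[i, i+m-2]\<close> and \<open>[i+m-1, n+m-2]\<close>.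
\<close>
lemma bij_betw_slot:
  assumes "n \<ge> 1" "m \<ge> 1" "i \<in> {1..n}"
  shows "bij_betw (slot m i) ({1..n - 1} <+> {1..m - 1}) {1..n + m - 1 - 1}"
  unfolding bij_betw_def
proof
  show "inj_on (slot m i) ({1..n - 1} <+> {1..m - 1})"
    using assms by (auto simp: inj_on_def split: if_splits)
  show "slot m i ` ({1..n - 1} <+> {1..m - 1}) = {1..n + m - 1 - 1}"
  proof (intro equalityI subsetI)
    fix u assume u: "u \<in> {1..n + m - 1 - 1}"
    consider "u < i" | "i \<le> u" "u < i + (m - 1)" | "i + (m - 1) \<le> u"
      by linarith
    then show "u \<in> slot m i ` ({1..n - 1} <+> {1..m - 1})"
    proof cases
      case 1
      with u assms show ?thesis by (intro image_eqI[of _ _ "Inl u"]) auto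
    next
      case 2
      with u assms show ?thesis by (intro image_eqI[of _ _ "Inr (u - (i - 1))"]) auto
    next
      case 3
      with u assms show ?thesis by (intro image_eqI[of _ _ "Inl (u - (m - 1))"]) auto
    qed
  qed (use assms in auto)
qed

text \<open>
  The three parts in the definition of \<open>B\<close> are the images of the elements of \<open>S\<close> below \<open>i\<close>, of \<open>T\<close>,
  and of the elements of \<open>S\<close> from \<open>i\<close> onwards. With this form in place, everything else about \<open>B\<close>
  is a general fact on images under injections.
\<close>
lemma B_eq_slot_image:
  assumes "S \<subseteq> {1..n - 1}" "i \<ge> 1"
  shows "B n m i S T = slot m i ` (S <+> T)"
proof -
  have "S = (S \<inter> {1..i - 1}) \<union> (S \<inter> {i..n - 1})"
    using assms by auto
  then have "slot m i ` (S <+> T) =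
      slot m i ` Inl ` (S \<inter> {1..i - 1}) \<union> slot m i ` Inl ` (S \<inter> {i..n - 1}) \<union> slot m i ` Inr ` T"
    unfolding Plus_def by blast
  also have "slot m i ` Inl ` (S \<inter> {1..i - 1}) = S \<inter> {1..i - 1}"
    using assms by (force simp: image_image)
  also have "slot m i ` Inl ` (S \<inter> {i..n - 1}) = shift (S \<inter> {i..n - 1}) (m - 1)"
    unfolding shift_def image_image by (intro image_cong) auto
  also have "slot m i ` Inr ` T = shift T (i - 1)"
    by (simp add: shift_def image_image)
  finally show ?thesis
    unfolding B_def by blast
qed

text \<open>
  Images under an injection and disjoint unions both commute with set difference, so the signs
  multiply as they should.
\<close>
lemma card_B_diff:
  assumes "n \<ge> 1" "m \<ge> 1" "i \<in> {1..n}"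
    and "S \<subseteq> S'" "S' \<subseteq> {1..n - 1}" "T \<subseteq> T'" "T' \<subseteq> {1..m - 1}"
  shows "card (B n m i S' T' - B n m i S T) = card (S' - S) + card (T' - T)"
proof -
  have inj: "inj_on (slot m i) ({1..n - 1} <+> {1..m - 1})"
    using bij_betw_slot assms by (blast dest: bij_betw_imp_inj_on)
  have "S \<subseteq> {1..n - 1}" using assms by blast
  then have "B n m i S' T' - B n m i S T = slot m i ` (S' <+> T') - slot m i ` (S <+> T)"
    using assms by (simp add: B_eq_slot_image)
  also have "\<dots> = slot m i ` ((S' <+> T') - (S <+> T))"
    using assms by (intro inj_on_image_set_diff[OF inj, symmetric]) auto
  also have "(S' <+> T') - (S <+> T) = (S' - S) <+> (T' - T)"
    by auto
  also have "card (slot m i ` \<dots>) = card ((S' - S) <+> (T' - T))"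
    using assms by (intro card_image inj_on_subset[OF inj]) auto
  also have "\<dots> = card (S' - S) + card (T' - T)"
    using assms by (intro card_Plus) (blast intro: finite_subset[OF _ finite_atLeastAtMost])+
  finally show ?thesis .
qed

text \<open>
  Every subset of a disjoint union is a disjoint union of subsets in exactly one way, and taking
  images under the bijection \<open>slot m i\<close> both preserves and reflects inclusion. So \<open>B n m i\<close> is an
  isomorphism of Boolean lattices, and it maps what lies above \<open>(S, T)\<close> onto what lies above
  \<open>B n m i S T\<close>. This is what reindexes the sum in the theorem.
\<close>
lemma bij_betw_B:
  assumes "n \<ge> 1" "m \<ge> 1" "i \<in> {1..n}" "S \<subseteq> {1..n - 1}" "T \<subseteq> {1..m - 1}"
  shows "bij_betw (\<lambda>(S', T'). B n m i S' T')
    ({S'. S \<subseteq> S' \<and> S' \<subseteq> {1..n - 1}} \<times> {T'. T \<subseteq> T' \<and> T' \<subseteq> {1..m - 1}})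
    {U. B n m i S T \<subseteq> U \<and> U \<subseteq> {1..n + m - 1 - 1}}"
proof -
  let ?D = "{1..n - 1} <+> {1..m - 1}"
  have inj: "inj_on (slot m i) ?D" and im: "slot m i ` ?D = {1..n + m - 1 - 1}"
    using bij_betw_slot[OF assms(1-3)] by (simp_all add: bij_betw_def)
  have B: "B n m i S' T' = slot m i ` (S' <+> T')" if "S' \<subseteq> {1..n - 1}" for S' T'
    using that assms by (intro B_eq_slot_image) auto
  have sub_iff: "slot m i ` X \<subseteq> slot m i ` Y \<longleftrightarrow> X \<subseteq> Y" if "X \<subseteq> ?D" "Y \<subseteq> ?D" for X Y
    using inj_on_image_mem_iff[OF inj] that by blast
  have D: "S' <+> T' \<subseteq> ?D \<longleftrightarrow> S' \<subseteq> {1..n - 1} \<and> T' \<subseteq> {1..m - 1}" for S' T'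
    by (auto simp: subset_iff Plus_def)
  have Plus_sub: "S1 <+> T1 \<subseteq> S2 <+> T2 \<longleftrightarrow> S1 \<subseteq> S2 \<and> T1 \<subseteq> T2"
    for S1 S2 T1 T2 :: "nat set"
    by (auto simp: subset_iff Plus_def)
  have mono: "B n m i S1 T1 \<subseteq> B n m i S2 T2 \<longleftrightarrow> S1 \<subseteq> S2 \<and> T1 \<subseteq> T2"
    if "S1 \<subseteq> {1..n - 1}" "T1 \<subseteq> {1..m - 1}" "S2 \<subseteq> {1..n - 1}" "T2 \<subseteq> {1..m - 1}" for S1 T1 S2 T2
  proof -
    have "B n m i S1 T1 \<subseteq> B n m i S2 T2 \<longleftrightarrow> S1 <+> T1 \<subseteq> S2 <+> T2"
      unfolding B[OF that(1)] B[OF that(3)] by (intro sub_iff) (simp_all only: D that simp_thms)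
    then show ?thesis by (simp only: Plus_sub)
  qed
  show ?thesis
    unfolding bij_betw_def
  proof
    \<comment> \<open>An order embedding is injective.\<close>
    show "inj_on (\<lambda>(S', T'). B n m i S' T')
        ({S'. S \<subseteq> S' \<and> S' \<subseteq> {1..n - 1}} \<times> {T'. T \<subseteq> T' \<and> T' \<subseteq> {1..m - 1}})"
    proof (rule inj_onI, clarify)
      fix S1 T1 S2 T2
      assume "S1 \<subseteq> {1..n - 1}" "T1 \<subseteq> {1..m - 1}" "S2 \<subseteq> {1..n - 1}" "T2 \<subseteq> {1..m - 1}"
        and "B n m i S1 T1 = B n m i S2 T2"
      then show "S1 = S2 \<and> T1 = T2"
        using mono[of S1 T1 S2 T2] mono[of S2 T2 S1 T1] by blast
    qed
    show "(\<lambda>(S', T'). B n m i S' T') `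
        ({S'. S \<subseteq> S' \<and> S' \<subseteq> {1..n - 1}} \<times> {T'. T \<subseteq> T' \<and> T' \<subseteq> {1..m - 1}})
      = {U. B n m i S T \<subseteq> U \<and> U \<subseteq> {1..n + m - 1 - 1}}"
    proof (intro equalityI subsetI)
      fix U
      assume "U \<in> (\<lambda>(S', T'). B n m i S' T') `
        ({S'. S \<subseteq> S' \<and> S' \<subseteq> {1..n - 1}} \<times> {T'. T \<subseteq> T' \<and> T' \<subseteq> {1..m - 1}})"
      then obtain S' T' where *: "U = B n m i S' T'" "S \<subseteq> S'" "S' \<subseteq> {1..n - 1}"
          "T \<subseteq> T'" "T' \<subseteq> {1..m - 1}"
        by auto
      moreover from * have "U \<subseteq> {1..n + m - 1 - 1}"
        using B_in_Q[of n m i S' T'] assms by (simp add: Q_def)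
      ultimately show "U \<in> {U. B n m i S T \<subseteq> U \<and> U \<subseteq> {1..n + m - 1 - 1}}"
        using mono assms by simp
    next
      fix U assume "U \<in> {U. B n m i S T \<subseteq> U \<and> U \<subseteq> {1..n + m - 1 - 1}}"
      then have U: "B n m i S T \<subseteq> U" "U \<subseteq> slot m i ` ?D"
        using im by auto
      obtain W where W: "W \<subseteq> ?D" "U = slot m i ` W"
        using U(2) unfolding subset_image_iff by blast
      define S' T' where "S' = Inl -` W" and "T' = Inr -` W"
      have eq: "W = S' <+> T'"
      proof (rule set_eqI)
        show "w \<in> W \<longleftrightarrow> w \<in> S' <+> T'" for w
          by (cases w) (auto simp: S'_def T'_def)
      qed
      with W D have *: "S' \<subseteq> {1..n - 1}" "T' \<subseteq> {1..m - 1}" by simp_all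
      with W eq B have "U = B n m i S' T'" by simp
      with U(1) mono * assms(4,5) show "U \<in> (\<lambda>(S', T'). B n m i S' T') `
        ({S'. S \<subseteq> S' \<and> S' \<subseteq> {1..n - 1}} \<times> {T'. T \<subseteq> T' \<and> T' \<subseteq> {1..m - 1}})"
        by (intro image_eqI[of _ _ "(S', T')"]) simp_all
    qed
  qed
qed

lemma pcomp_zero [simp]: "pcomp n m i 0 y = 0" "pcomp n m i x 0 = 0"
  by (simp_all add: pcomp_def)

lemma pcomp_sum_left: "pcomp n m i (sum f A) y = (\<Sum>a\<in>A. pcomp n m i (f a) y)"
  by (induction A rule: infinite_finite_induct) (simp_all add: pcomp_add_left)

lemma pcomp_sum_right: "pcomp n m i x (sum f A) = (\<Sum>a\<in>A. pcomp n m i x (f a))"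
  by (induction A rule: infinite_finite_induct) (simp_all add: pcomp_add_right)

lemma pcomp_smult_F:
  "pcomp n m i (c \<cdot> F S) (d \<cdot> F T) = (c * d) \<cdot> F (B n m i S T)"
  by (simp add: pcomp_smult_left pcomp_smult_right pcomp_F) (simp add: smult_F smult_single mult.commute)

theorem proposition3p3:
  fixes n m i :: nat and S T :: "nat set"
  assumes "n \<ge> 1" and "m \<ge> 1"
    and "S \<in> Q n" and "T \<in> Q m"
    and "i \<in> {1..n}"
  shows "pcomp n m i (M n S) (M m T)
    = (M (n + m - 1) (B n m i S T) :: nat set \<Rightarrow>\<^sub>0 'k::{comm_ring, comm_monoid_mult})"
proof -
  let ?A = "{S'. S \<subseteq> S' \<and> S' \<subseteq> {1..n - 1}}" and ?C = "{T'. T \<subseteq> T' \<and> T' \<subseteq> {1..m - 1}}"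
  have ST: "S \<subseteq> {1..n - 1}" "T \<subseteq> {1..m - 1}"
    using assms by (simp_all add: Q_def)
  have "pcomp n m i (M n S) (M m T) =
      (\<Sum>S'\<in>?A. \<Sum>T'\<in>?C. ((- 1 :: 'k) ^ card (S' - S) * (- 1) ^ card (T' - T)) \<cdot> F (B n m i S' T'))"
    unfolding M_def pcomp_sum_left by (simp add: pcomp_sum_right pcomp_smult_F)
  also have "\<dots> = (\<Sum>(S', T')\<in>?A \<times> ?C.
      (- 1) ^ card (B n m i S' T' - B n m i S T) \<cdot> F (B n m i S' T'))"
    unfolding sum.cartesian_product
    using assms ST by (intro sum.cong refl) (auto simp: card_B_diff power_add)
  also have "\<dots> = M (n + m - 1) (B n m i S T)"
    unfolding M_def
    using sum.reindex_bij_betw[OF bij_betw_B[OF assms(1,2,5) ST],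
        of "\<lambda>U. (- 1 :: 'k) ^ card (U - B n m i S T) \<cdot> F U"]
    by (simp add: case_prod_unfold)
  finally show ?thesis .
qed

end
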